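(* Let $X$ be a Banach space and let $f\colon X\to\mathbb{R}\cup\{+\infty\}$ be a proper lower semicontinuous convex function. Suppose $-\infty<\alpha<\beta\le+\infty$ and $\tau>0$. Consider the following statements: (i) $\displaystyle \inf_{x\in[f=\alpha]}\operatorname{dist}(0,\partial f(x))\ge\frac1\tau$. (ii) $\displaystyle \inf_{x\in[\alpha<f<\beta]}\operatorname{dist}(0,\partial f(x))\ge\frac1\tau$. (iii) $\tau\,(f(x)-\alpha)\ge\operatorname{dist}(x,[f\le\alpha])$ for all $x\in[\alpha<f<\beta]$. Then (i) implies (ii), and (ii) is equivalent to (iii).
   Context: $X^*$ is the topological dual of $X$ with the dual norm. For $x\in\operatorname{dom} f=\{x\in X: f(x)<+\infty\}$, $\partial f(x)=\{u\in X^* : \langle u,y-x\rangle\le f(y)-f(x)\ \text{for all } y\in X\}$ is the convex subdifferential. Level sets: $[f\le\alpha]=\{x\in X: f(x)\le\alpha\}$, $[f=\alpha]=\{x\in X: f(x)=\alpha\}$, $[\alpha<f<\beta]=\{x\in X:\alpha<f(x)<\beta\}$. For a subset $S$ of a normed space, $\operatorname{dist}(x,S)=\inf_{u\in S}\|x-u\|$, with the usual convention that an infimum over the empty set is $+\infty$.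
   Formalization: The implication (i) ⇒ (ii) is stated under the added assumption that [f ≤ α] is nonempty; without it the claim fails, e.g. X = ℝ, f(x) = |x|, α = −1, β = +∞, τ = 1, where [f = α] is empty so (i) holds vacuously but (ii) fails at x = 0. *)

theory Defs
  imports "HOL-Analysis.Analysis"
begin

definition proper_fun :: "('a \<Rightarrow> ereal) \<Rightarrow> bool" where
  "proper_fun f \<longleftrightarrow> (\<forall>x. f x \<noteq> -\<infinity>) \<and> (\<exists>x. f x < \<infinity>)"

(* The limit inferior along "at x" is over punctured neighbourhoods; since f x itself is on the
   left-hand side, full neighbourhoods would give the same notion. *)
definition lsc_fun :: "('a::topological_space \<Rightarrow> ereal) \<Rightarrow> bool" where
  "lsc_fun f \<longleftrightarrow> (\<forall>x. f x \<le> Liminf (at x) f)"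

(* The endpoints t = 0 and t = 1 are excluded, so no product 0 * \<infinity> occurs; for functions that
   never take the value -\<infinity> no sum \<infinity> - \<infinity> occurs either. *)
definition convex_fun :: "('a::real_vector \<Rightarrow> ereal) \<Rightarrow> bool" where
  "convex_fun f \<longleftrightarrow>
     (\<forall>x y t. 0 < t \<and> t < 1 \<longrightarrow>
        f ((1 - t) *\<^sub>R x + t *\<^sub>R y) \<le> ereal (1 - t) * f x + ereal t * f y)"

(* The dual space is the type of bounded linear functionals with its operator norm.
   The subdifferential is empty outside the effective domain. *)
definition subdifferential :: "('a::real_normed_vector \<Rightarrow> ereal) \<Rightarrow> 'a \<Rightarrow> ('a \<Rightarrow>\<^sub>L real) set" where
  "subdifferential f x =
     {u. f x < \<infinity> \<and> (\<forall>y. ereal (blinfun_apply u (y - x)) \<le> f y - f x)}"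

(* Unlike infdist, which is 0 for the empty set, this is \<infinity> there. *)
definition dist_to_set :: "'a::real_normed_vector \<Rightarrow> 'a set \<Rightarrow> ereal" where
  "dist_to_set x S = (INF u\<in>S. ereal (norm (x - u)))"

end

(* By Hahn-Banach, f has a subgradient of norm at most K at z as soon as f y >= f z - K |y - z| for
   all y. If the error bound (iii) fails at x, Ekeland's variational principle supplies such a z with
   K < 1/tau: applied to max (f - alpha) 0 it gives z in [alpha < f <= f x], which contradicts (ii);
   applied to the distance from x on [f <= alpha] it gives z in [f = alpha], which contradicts (i).
   Conversely, (iii) gives (ii) by the subgradient inequality at points of [f <= alpha]. *)

theory Submission
  imports Defs
begin

section \<open>Sublinear functionals and the Hahn-Banach theorem\<close>

text \<open>Only an inequality for positive scalars is demanded, which is easy to check for infima;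
  applying it to the inverse scalar recovers equality in \<open>sublinear_scale\<close>.\<close>

definition sublinear :: "('a::real_vector \<Rightarrow> real) \<Rightarrow> bool" where
  "sublinear p \<longleftrightarrow> (\<forall>x y. p (x + y) \<le> p x + p y) \<and> (\<forall>c x. c > 0 \<longrightarrow> p (c *\<^sub>R x) \<le> c * p x)"

lemma sublinear_add: "sublinear p \<Longrightarrow> p (x + y) \<le> p x + p y"
  and sublinear_scale_le: "sublinear p \<Longrightarrow> c > 0 \<Longrightarrow> p (c *\<^sub>R x) \<le> c * p x"
  by (auto simp: sublinear_def)

lemma sublinear_0:
  assumes "sublinear p"
  shows "p 0 = 0"
  using sublinear_scale_le[OF assms, of 2 0] sublinear_scale_le[OF assms, of "1/2" 0] by simp

lemma sublinear_scale:
  assumes "sublinear p" "c \<ge> 0"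
  shows "p (c *\<^sub>R x) = c * p x"
proof (cases "c = 0")
  case True
  then show ?thesis using sublinear_0[OF assms(1)] by simp
next
  case False
  then have c: "c > 0" using assms by simp
  have "p (inverse c *\<^sub>R (c *\<^sub>R x)) \<le> inverse c * p (c *\<^sub>R x)"
    using c by (intro sublinear_scale_le[OF assms(1)]) simp
  then have "c * p x \<le> p (c *\<^sub>R x)" using c by (simp add: field_simps)
  with sublinear_scale_le[OF assms(1) c, of x] show ?thesis by simp
qed

lemma sublinear_minus_ge:
  assumes "sublinear p"
  shows "- p (- x) \<le> p x"
  using sublinear_add[OF assms, of x "- x"] sublinear_0[OF assms] by simp

text \<open>Serves three infima: along a ray in \<open>minimal_sublinear_linear\<close>, over a
  chain in Zorn's lemma, and over the epigraph in \<open>subgradient_of_slope_bound\<close>. Each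
  time it remains only to name the index \<open>k\<close> that absorbs a sum or a multiple.\<close>

lemma sublinear_INF:
  fixes h :: "'i \<Rightarrow> 'a::real_vector \<Rightarrow> real"
  assumes "I \<noteq> {}"
    and bdd: "\<And>x. bdd_below ((\<lambda>i. h i x) ` I)"
    and add: "\<And>i j x y. i \<in> I \<Longrightarrow> j \<in> I \<Longrightarrow> \<exists>k\<in>I. h k (x + y) \<le> h i x + h j y"
    and scale: "\<And>i c x. i \<in> I \<Longrightarrow> c > 0 \<Longrightarrow> \<exists>k\<in>I. h k (c *\<^sub>R x) \<le> c * h i x"
  shows "sublinear (\<lambda>x. INF i\<in>I. h i x)"
proof -
  let ?p = "\<lambda>x. INF i\<in>I. h i x"
  have le: "?p x \<le> h i x" if "i \<in> I" for i x
    using that bdd by (intro cINF_lower)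
  have "?p (x + y) \<le> ?p x + ?p y" for x y
  proof -
    have *: "?p (x + y) \<le> h i x + h j y" if "i \<in> I" "j \<in> I" for i j
      using add[OF that] le order_trans by blast
    have "?p (x + y) - h i x \<le> ?p y" if "i \<in> I" for i
      using *[OF that] assms(1) by (intro cINF_greatest) (auto simp: algebra_simps)
    then have "?p (x + y) - ?p y \<le> ?p x"
      using assms(1) by (intro cINF_greatest) (auto simp: algebra_simps)
    then show ?thesis by simp
  qed
  moreover have "?p (c *\<^sub>R x) \<le> c * ?p x" if "c > 0" for c x
  proof -
    have *: "?p (c *\<^sub>R x) \<le> c * h i x" if "i \<in> I" for i
      using scale[OF that \<open>c > 0\<close>] le order_trans by blast
    have "?p (c *\<^sub>R x) / c \<le> ?p x"
      using * assms(1) that by (intro cINF_greatest) (auto simp: field_simps)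
    then show ?thesis using that by (simp add: field_simps)
  qed
  ultimately show ?thesis by (auto simp: sublinear_def)
qed

text \<open>Lowering \<open>p\<close> along \<open>v\<close> to the infimum of
  \<open>p (x + t v) - t p v\<close> over \<open>t \<ge> 0\<close> gives a sublinear functional
  below \<open>p\<close> (take \<open>t = 0\<close>). By minimality it is \<open>p\<close> itself,
  and \<open>t = 1\<close> yields the missing superadditivity.\<close>

lemma minimal_sublinear_linear:
  assumes p: "sublinear p"
    and min: "\<And>q. sublinear q \<Longrightarrow> q \<le> p \<Longrightarrow> q = p"
  shows "linear p"
proof -
  have add: "p (x + v) = p x + p v" for x v
  proof -
    let ?h = "\<lambda>t x. p (x + t *\<^sub>R v) - t * p v"
    have bdd: "bdd_below ((\<lambda>t. ?h t x) ` {0..})" for x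
    proof (rule bdd_belowI2)
      fix t :: real assume "t \<in> {0..}"
      then have "t * p v = p (t *\<^sub>R v)" using sublinear_scale[OF p] by simp
      also have "\<dots> \<le> p (x + t *\<^sub>R v) + p (- x)"
        using sublinear_add[OF p, of "x + t *\<^sub>R v" "- x"] by simp
      finally show "- p (- x) \<le> ?h t x" by simp
    qed
    have le: "(INF t\<in>{0..}. ?h t x) \<le> ?h t x" if "t \<ge> 0" for t x
      using that bdd by (intro cINF_lower) auto
    have "sublinear (\<lambda>x. INF t\<in>{0..}. ?h t x)"
    proof (rule sublinear_INF)
      fix s t x y assume "s \<in> {0::real..}" "t \<in> {0::real..}"
      then show "\<exists>k\<in>{0..}. ?h k (x + y) \<le> ?h s x + ?h t y"
        using sublinear_add[OF p, of "x + s *\<^sub>R v" "y + t *\<^sub>R v"]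
        by (intro bexI[of _ "s + t"]) (auto simp: algebra_simps)
    next
      fix t c x assume "t \<in> {0::real..}" "c > (0::real)"
      then show "\<exists>k\<in>{0..}. ?h k (c *\<^sub>R x) \<le> c * ?h t x"
        using sublinear_scale_le[OF p, of c "x + t *\<^sub>R v"]
        by (intro bexI[of _ "c * t"]) (auto simp: algebra_simps)
    qed (use bdd in auto)
    moreover have "(\<lambda>x. INF t\<in>{0..}. ?h t x) \<le> p"
      using le[of 0] by (auto simp: le_fun_def)
    ultimately have "(\<lambda>x. INF t\<in>{0..}. ?h t x) = p"
      by (rule min)
    then have "(INF t\<in>{0..}. ?h t x) = p x"
      by (rule fun_cong)
    then have "p x + p v \<le> p (x + v)" using le[of 1 x] by simp
    then show ?thesis using sublinear_add[OF p, of x v] by simp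
  qed
  have minus: "p (- x) = - p x" for x
    using add[of x "- x"] sublinear_0[OF p] by simp
  show ?thesis
  proof (rule linearI)
    fix c x
    show "p (c *\<^sub>R x) = c *\<^sub>R p x"
      using sublinear_scale[OF p, of c x] sublinear_scale[OF p, of "- c" x] minus[of "c *\<^sub>R x"]
      by (cases "c \<ge> 0") auto
  qed (rule add)
qed

theorem Hahn_Banach_sublinear:
  assumes q: "sublinear q"
  obtains u where "linear u" "\<And>x. u x \<le> q x"
proof -
  let ?A = "{p. sublinear p \<and> p \<le> q}"
  \<comment> \<open>The order is reversed, so that the maximal element from Zorn's lemma is a
    minimal sublinear functional.\<close>
  let ?P = "\<lambda>p p' :: 'a \<Rightarrow> real. p' \<le> p"
  have "\<exists>m\<in>?A. \<forall>a\<in>?A. ?P m a \<longrightarrow> a = m"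
  proof (rule predicate_Zorn)
    show "partial_order_on ?A (relation_of ?P ?A)"
      by (rule partial_order_on_relation_ofI) auto
  next
    fix C assume "C \<in> Chains (relation_of ?P ?A)"
    then have CA: "C \<subseteq> ?A" and ch: "\<And>a b. a \<in> C \<Longrightarrow> b \<in> C \<Longrightarrow> a \<le> b \<or> b \<le> a"
      by (auto simp: Chains_def relation_of_def)
    show "\<exists>m\<in>?A. \<forall>a\<in>C. m \<le> a"
    proof (cases "C = {}")
      case True
      then show ?thesis using q by auto
    next
      case False
      have bdd: "bdd_below ((\<lambda>p. p x) ` C)" for x
      proof (rule bdd_belowI2)
        fix p assume "p \<in> C"
        then have "sublinear p" "p (- x) \<le> q (- x)" using CA by (auto simp: le_fun_def)
        then show "- q (- x) \<le> p x" using sublinear_minus_ge[of p x] by linarith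
      qed
      let ?m = "\<lambda>x. INF p\<in>C. p x"
      have le: "?m \<le> p" if "p \<in> C" for p
        unfolding le_fun_def using that bdd by (intro allI cINF_lower)
      have "sublinear ?m"
      proof (rule sublinear_INF[OF False bdd])
        \<comment> \<open>The smaller of two members of the chain serves as the index for the
          sum.\<close>
        fix p p' x y assume *: "p \<in> C" "p' \<in> C"
        with ch consider "p \<le> p'" | "p' \<le> p" by blast
        then show "\<exists>k\<in>C. k (x + y) \<le> p x + p' y"
        proof cases
          case 1
          have "p (x + y) \<le> p x + p y" using CA * sublinear_add by blast
          with 1 have "p (x + y) \<le> p x + p' y" by (smt (verit) le_fun_def)
          then show ?thesis using * by blast
        next
          case 2
          have "p' (x + y) \<le> p' x + p' y" using CA * sublinear_add by blast
          with 2 have "p' (x + y) \<le> p x + p' y" by (smt (verit) le_fun_def)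
          then show ?thesis using * by blast
        qed
      next
        fix p c x assume "p \<in> C" "c > (0::real)"
        then show "\<exists>k\<in>C. k (c *\<^sub>R x) \<le> c * p x"
          using CA sublinear_scale_le by blast
      qed
      moreover have "?m \<le> q"
      proof -
        obtain p where "p \<in> C" using False by blast
        then have "?m \<le> p" "p \<le> q" using le CA by auto
        then show ?thesis by (rule order_trans)
      qed
      ultimately show ?thesis using le by blast
    qed
  qed
  then obtain m where m: "sublinear m" "m \<le> q" "\<And>a. sublinear a \<Longrightarrow> a \<le> q \<Longrightarrow> a \<le> m \<Longrightarrow> a = m"
    by blast
  have "linear m"
    using m(1)
  proof (rule minimal_sublinear_linear)
    fix a assume a: "sublinear a" "a \<le> m"
    show "a = m" by (rule m(3)[OF a(1) order_trans[OF a(2) m(2)] a(2)])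
  qed
  with m that show thesis by (auto simp: le_fun_def)
qed

section \<open>Subgradients from a bound on the slope\<close>

lemma convex_funD:
  assumes "convex_fun f" "f x \<le> ereal a" "f y \<le> ereal b" "0 < t" "t < 1"
  shows "f ((1 - t) *\<^sub>R x + t *\<^sub>R y) \<le> ereal ((1 - t) * a + t * b)"
proof -
  have "f ((1 - t) *\<^sub>R x + t *\<^sub>R y) \<le> ereal (1 - t) * f x + ereal t * f y"
    using assms by (auto simp: convex_fun_def)
  also have "\<dots> \<le> ereal (1 - t) * ereal a + ereal t * ereal b"
    using assms by (intro add_mono ereal_mult_left_mono) auto
  finally show ?thesis by simp
qed

text \<open>The Hahn-Banach theorem is applied to the infimal convolution of \<open>K * norm d\<close> with the
  sublinear hull of the increment \<open>f (z + d) - f z\<close>; the slope bound keeps it finite.\<close>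

lemma subgradient_of_slope_bound:
  fixes f :: "'a::real_normed_vector \<Rightarrow> ereal"
  assumes conv: "convex_fun f" and nminf: "\<And>x. f x \<noteq> -\<infinity>"
    and z: "f z = ereal a" and "K \<ge> 0"
    and slope: "\<And>y b. f y = ereal b \<Longrightarrow> a - K * norm (y - z) \<le> b"
  obtains u where "u \<in> subdifferential f z" "norm u \<le> K"
proof -
  \<comment> \<open>\<open>h (s, y, b) d\<close> is the cost of reaching \<open>d\<close> by the
    multiple \<open>s (y - z)\<close> and paying \<open>K\<close> per unit of remaining distance.
    Epigraph points \<open>(y, b)\<close> replace values of \<open>f\<close>, so all costs are
    real.\<close>
  define I where "I = {(s, y, b). s > (0::real) \<and> f y \<le> ereal b}"
  define h where "h = (\<lambda>(s, y, b) d. s * (b - a) + K * norm (d - s *\<^sub>R (y - z)))"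
  have low: "- K * norm d \<le> h i d" if "i \<in> I" for i d
  proof -
    obtain s y b where i: "i = (s, y, b)" by (cases i)
    with that have s: "s > 0" and fy: "f y \<le> ereal b" by (auto simp: I_def)
    have "a - K * norm (y - z) \<le> b"
      using fy slope nminf[of y] by (cases "f y") force+
    then have "s * (- K * norm (y - z)) \<le> s * (b - a)"
      using s by (intro mult_left_mono) auto
    moreover have "K * norm (s *\<^sub>R (y - z)) \<le> K * (norm d + norm (d - s *\<^sub>R (y - z)))"
      using \<open>K \<ge> 0\<close> by (intro mult_left_mono) (metis norm_triangle_sub add.commute norm_minus_commute)
    ultimately show ?thesis
      using s unfolding i h_def prod.case by (simp add: abs_of_pos) (simp add: algebra_simps)
  qed
  have bdd: "bdd_below ((\<lambda>i. h i d) ` I)" for d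
    using low by (intro bdd_belowI2)
  have I1: "(1, y, b) \<in> I" if "f y \<le> ereal b" for y b using that by (simp add: I_def)
  let ?q = "\<lambda>d. INF i\<in>I. h i d"
  have qle: "?q d \<le> h i d" if "i \<in> I" for i d
    using that bdd by (intro cINF_lower)
  have "sublinear ?q"
  proof (rule sublinear_INF)
    show "I \<noteq> {}" using I1[of z a] z by auto
  next
    fix i j d e assume ij: "i \<in> I" "j \<in> I"
    obtain s y b t w c where i: "i = (s, y, b)" and j: "j = (t, w, c)" by (cases i, cases j)
    with ij have s: "s > 0" "f y \<le> ereal b" and t: "t > 0" "f w \<le> ereal c"
      by (auto simp: I_def)
    \<comment> \<open>Averaging the epigraph points with weights proportional to \<open>s\<close>
      and \<open>t\<close> makes the scaled increments add exactly; the norm terms then obey the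
      triangle inequality.\<close>
    define r where "r = t / (s + t)"
    have r: "0 < r" "r < 1" using s t by (auto simp: r_def)
    let ?v = "(1 - r) *\<^sub>R y + r *\<^sub>R w" and ?g = "(1 - r) * b + r * c"
    have *: "(s + t) * r = t" "(s + t) * (1 - r) = s" using s t by (auto simp: r_def field_simps)
    have k: "(s + t, ?v, ?g) \<in> I"
      using convex_funD[OF conv s(2) t(2) r] s t by (auto simp: I_def)
    have "(s + t) *\<^sub>R ?v = s *\<^sub>R y + t *\<^sub>R w"
      by (simp add: scaleR_add_right *)
    then have v: "(s + t) *\<^sub>R (?v - z) = s *\<^sub>R (y - z) + t *\<^sub>R (w - z)"
      by (simp add: algebra_simps)
    have "(s + t) * ?g = ((s + t) * (1 - r)) * b + ((s + t) * r) * c" by (simp add: algebra_simps)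
    then have g: "(s + t) * (?g - a) = s * (b - a) + t * (c - a)"
      unfolding * by (simp add: algebra_simps)
    have "norm (d + e - (s + t) *\<^sub>R (?v - z)) \<le> norm (d - s *\<^sub>R (y - z)) + norm (e - t *\<^sub>R (w - z))"
      unfolding v by (rule order_trans[OF _ norm_triangle_ineq]) (simp add: algebra_simps)
    then have "K * norm (d + e - (s + t) *\<^sub>R (?v - z))
        \<le> K * (norm (d - s *\<^sub>R (y - z)) + norm (e - t *\<^sub>R (w - z)))"
      using \<open>K \<ge> 0\<close> by (rule mult_left_mono)
    then have "h (s + t, ?v, ?g) (d + e) \<le> h i d + h j e"
      unfolding i j h_def prod.case g by (simp add: distrib_left)
    with k show "\<exists>k\<in>I. h k (d + e) \<le> h i d + h j e" by blast
  next
    fix i c d assume i: "i \<in> I" "c > (0::real)"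
    obtain s y b where i': "i = (s, y, b)" by (cases i)
    have "norm (c *\<^sub>R d - (c * s) *\<^sub>R (y - z)) = c * norm (d - s *\<^sub>R (y - z))"
      using i(2) by (metis abs_of_pos norm_scaleR scaleR_diff_right scaleR_scaleR)
    then have "h (c * s, y, b) (c *\<^sub>R d) = c * h i d"
      by (simp add: i' h_def algebra_simps)
    moreover have "(c * s, y, b) \<in> I" using i by (auto simp: i' I_def)
    ultimately show "\<exists>k\<in>I. h k (c *\<^sub>R d) \<le> c * h i d" by force
  qed (rule bdd)
  then obtain u where u: "linear u" "\<And>d. u d \<le> ?q d" by (rule Hahn_Banach_sublinear) blast
  \<comment> \<open>The index \<open>(1, z, a)\<close> costs exactly \<open>K * norm d\<close>.
    Below, the index \<open>(1, y, b)\<close> at \<open>d = y - z\<close> has no norm term and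
    yields the subgradient inequality.\<close>
  have uK: "u d \<le> K * norm d" for d
    using u(2)[of d] qle[OF I1[of z a], of d] z by (simp add: h_def)
  have "\<bar>u d\<bar> \<le> K * norm d" for d
    using uK[of d] uK[of "- d"] linear_neg[OF u(1)] by (simp add: abs_le_iff)
  then have bl: "bounded_linear u"
    using u(1) by (intro bounded_linear_intro[of _ K]) (auto simp: linear_add linear_scale mult.commute)
  have ap: "blinfun_apply (Blinfun u) = u" using bl by (rule bounded_linear_Blinfun_apply)
  have "norm (Blinfun u) \<le> K"
    using \<open>K \<ge> 0\<close> \<open>\<And>d. \<bar>u d\<bar> \<le> K * norm d\<close> by (intro norm_blinfun_bound) (auto simp: ap)
  moreover have "ereal (u (y - z)) \<le> f y - f z" for y
  proof (cases "f y")
    case (real b)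
    then show ?thesis
      using u(2)[of "y - z"] qle[OF I1[of y b], of "y - z"] z by (simp add: h_def)
  qed (use nminf[of y] z in auto)
  then have "Blinfun u \<in> subdifferential f z"
    by (simp add: subdifferential_def ap z)
  ultimately show thesis using that by blast
qed

section \<open>Ekeland's variational principle\<close>

text \<open>Almost minimising \<open>g\<close> repeatedly over the nested sets
  \<open>F (X n)\<close> shrinks them to a single point \<open>z\<close>. Semicontinuity enters
  through closed sublevel sets within \<open>C\<close>, so that \<open>C\<close> may be an effective
  domain, which is not closed in general.\<close>

theorem Ekeland:
  fixes g :: "'a::complete_space \<Rightarrow> real"
  assumes closed: "\<And>c. closed {y \<in> C. g y \<le> c}"
    and nonneg: "\<And>y. y \<in> C \<Longrightarrow> 0 \<le> g y"
    and "x \<in> C" "K > 0"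
  obtains z where "z \<in> C" "g z + K * dist z x \<le> g x"
    "\<And>y. y \<in> C \<Longrightarrow> g z \<le> g y + K * dist y z"
proof -
  define F where "F z = {y \<in> C. g y + K * dist y z \<le> g z}" for z
  have F_refl: "z \<in> F z" if "z \<in> C" for z using that by (simp add: F_def)
  have F_trans: "F y \<subseteq> F z" if "y \<in> F z" for y z
  proof
    fix w assume "w \<in> F y"
    moreover have "K * dist w z \<le> K * (dist w y + dist y z)"
      using \<open>K > 0\<close> by (intro mult_left_mono dist_triangle) auto
    ultimately show "w \<in> F z" using that by (auto simp: F_def algebra_simps)
  qed
  have bdd: "bdd_below (g ` F z)" for z
    using nonneg by (intro bdd_belowI2[of _ 0]) (auto simp: F_def)
  define P where "P n y y' \<longleftrightarrow> y' \<in> F y \<and> (\<forall>w\<in>F y. g y' \<le> g w + (1/2) ^ n)" for n :: nat and y y'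
  have "\<exists>X. \<forall>n. (X n \<in> C \<and> (n = 0 \<longrightarrow> X n = x)) \<and> P n (X n) (X (Suc n))"
  proof (rule dependent_nat_choice)
    fix y and n :: nat assume "y \<in> C \<and> (n = 0 \<longrightarrow> y = x)"
    then have ne: "F y \<noteq> {}" using F_refl by blast
    have "(INF w\<in>F y. g w) < (INF w\<in>F y. g w) + (1/2) ^ n" by simp
    then obtain y' where y': "y' \<in> F y" "g y' < (INF w\<in>F y. g w) + (1/2) ^ n"
      using cINF_less_iff[OF ne bdd] by blast
    have "g y' \<le> g w + (1/2) ^ n" if "w \<in> F y" for w
      using cINF_lower[OF bdd that] y'(2) by linarith
    with y' show "\<exists>y'. (y' \<in> C \<and> (Suc n = 0 \<longrightarrow> y' = x)) \<and> P n y y'"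
      by (auto simp: P_def F_def)
  qed (use \<open>x \<in> C\<close> in auto)
  then obtain X where XC: "\<And>n. X n \<in> C" and X0: "X 0 = x" and XP: "\<And>n. P n (X n) (X (Suc n))"
    by blast
  have mono: "F (X m) \<subseteq> F (X n)" if "n \<le> m" for m n
    using that by (rule lift_Suc_antimono_le[rotated]) (use XP F_trans P_def in blast)
  \<comment> \<open>A point \<open>w\<close> of \<open>F (X (Suc n))\<close> has \<open>g\<close>
    lower by at least \<open>K\<close> times its distance to \<open>X (Suc n)\<close>, yet by at
    most \<open>(1/2) ^ n\<close>, as \<open>X (Suc n)\<close> almost minimises \<open>g\<close>
    over the larger \<open>F (X n)\<close>.\<close>
  have small: "dist w (X (Suc n)) \<le> (1/2) ^ n / K" if "w \<in> F (X (Suc n))" for w n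
  proof -
    have "w \<in> F (X n)" using that mono[of n "Suc n"] by auto
    then have "g (X (Suc n)) \<le> g w + (1/2) ^ n" using XP[of n] by (auto simp: P_def)
    then have "K * dist w (X (Suc n)) \<le> (1/2) ^ n" using that by (auto simp: F_def)
    then show ?thesis using \<open>K > 0\<close> by (simp add: field_simps)
  qed
  have lim0: "(\<lambda>n. (1/2) ^ n / K) \<longlonglongrightarrow> 0"
    by (intro tendsto_divide_zero LIMSEQ_realpow_zero) auto
  have "Cauchy X"
    unfolding Cauchy_altdef2
  proof (intro allI impI)
    fix e :: real assume "e > 0"
    then obtain n where n: "(1/2) ^ n / K < e"
      using order_tendstoD(2)[OF lim0, of e] by (auto simp: eventually_sequentially)
    have "dist (X m) (X (Suc n)) < e" if "m \<ge> Suc n" for m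
      using small[of "X m" n] mono[OF that] F_refl[OF XC] n by fastforce
    then show "\<exists>N. \<forall>m\<ge>N. dist (X m) (X N) < e" by blast
  qed
  then obtain z where lim: "X \<longlonglongrightarrow> z" using Cauchy_convergent convergentD by blast
  have zF: "z \<in> F (X n)" for n
  proof -
    \<comment> \<open>The hypothesis concerns constant levels only, whereas the bound on
      \<open>g (X m)\<close> varies with \<open>m\<close>; the slack \<open>e\<close> puts almost
      all \<open>X m\<close> in one closed sublevel set.\<close>
    have *: "z \<in> {y \<in> C. g y \<le> g (X n) - K * dist z (X n) + e}" if "e > 0" for e
    proof (rule Lim_in_closed_set[OF closed])
      have "(\<lambda>m. g (X n) - K * dist (X m) (X n)) \<longlonglongrightarrow> g (X n) - K * dist z (X n)"
        by (intro tendsto_intros lim)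
      then have "\<forall>\<^sub>F m in sequentially. g (X n) - K * dist (X m) (X n) < g (X n) - K * dist z (X n) + e"
        by (rule order_tendstoD) (use that in simp)
      moreover have "\<forall>\<^sub>F m in sequentially. m \<ge> n" by (rule eventually_ge_at_top)
      ultimately show "\<forall>\<^sub>F m in sequentially. X m \<in> {y \<in> C. g y \<le> g (X n) - K * dist z (X n) + e}"
      proof eventually_elim
        case (elim m)
        have "X m \<in> F (X n)" using mono[OF elim(2)] F_refl[OF XC] by blast
        with elim(1) show ?case by (auto simp: F_def)
      qed
    qed (use lim in auto)
    have "g z \<le> g (X n) - K * dist z (X n)"
    proof (rule field_le_epsilon)
      fix e :: real assume "e > 0"
      from *[OF this] show "g z \<le> g (X n) - K * dist z (X n) + e" by blast
    qed
    moreover have "z \<in> C" using *[of 1] by simp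
    ultimately show ?thesis by (simp add: F_def)
  qed
  show thesis
  proof
    show "z \<in> C" "g z + K * dist z x \<le> g x" using zF[of 0] X0 by (auto simp: F_def)
  next
    fix y assume "y \<in> C"
    show "g z \<le> g y + K * dist y z"
    proof (rule ccontr)
      assume less: "\<not> ?thesis"
      \<comment> \<open>A violating \<open>y\<close> lies in every \<open>F (X n)\<close>, so it is
        the limit \<open>z\<close> itself.\<close>
      with \<open>y \<in> C\<close> have "y \<in> F z" by (simp add: F_def)
      then have yF: "y \<in> F (X n)" for n using F_trans[OF zF] by blast
      have "dist y z = 0"
      proof (rule LIMSEQ_unique)
        show "(\<lambda>n. dist y (X (Suc n))) \<longlonglongrightarrow> dist y z"
          by (intro tendsto_intros LIMSEQ_Suc lim)
        show "(\<lambda>n. dist y (X (Suc n))) \<longlonglongrightarrow> 0"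
          by (rule tendsto_sandwich[OF _ _ tendsto_const lim0]) (use small[OF yF] in auto)
      qed
      with less show False by simp
    qed
  qed
qed

section \<open>Small subgradients where the error bound fails\<close>

lemma lsc_fun_closed_sublevel:
  assumes "lsc_fun f"
  shows "closed {y. f y \<le> c}"
proof -
  have "open {y. c < f y}"
  proof (subst open_subopen, safe)
    fix x assume x: "c < f x"
    then have "c < Liminf (at x) f" using assms by (auto simp: lsc_fun_def intro: less_le_trans)
    then have "\<forall>\<^sub>F y in at x. c < f y" by (rule less_LiminfD)
    with x have "\<forall>\<^sub>F y in nhds x. c < f y" by (simp add: eventually_nhds_conv_at)
    then show "\<exists>T. open T \<and> x \<in> T \<and> T \<subseteq> {y. c < f y}" by (auto simp: eventually_nhds)
  qed
  then show ?thesis by (simp add: closed_def Compl_eq not_le)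
qed

text \<open>An Ekeland point of \<open>max (f - \<alpha>) 0\<close> that stays off \<open>[f \<le> \<alpha>]\<close> is a local, hence by convexity
  a global, minimiser of \<open>f + K * norm (\<cdot> - z)\<close>.\<close>

lemma small_subgradient_above_level:
  fixes f :: "'a::banach \<Rightarrow> ereal"
  assumes conv: "convex_fun f" and lsc: "lsc_fun f" and nminf: "\<And>x. f x \<noteq> -\<infinity>"
    and x: "f x = ereal a" "\<alpha> < a" and "\<tau> > 0"
    and far: "ereal (\<tau> * (a - \<alpha>)) < dist_to_set x {y. f y \<le> ereal \<alpha>}"
  obtains z u where "ereal \<alpha> < f z" "f z \<le> f x" "u \<in> subdifferential f z" "norm u < 1 / \<tau>"
proof -
  \<comment> \<open>With \<open>l\<close> strictly in between, the slope
    \<open>K = (a - \<alpha>) / l\<close> is below \<open>1 / \<tau>\<close>, and a total descent of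
    \<open>a - \<alpha>\<close> confines the Ekeland point to distance \<open>l\<close> from
    \<open>x\<close>, hence off the level set.\<close>
  obtain l where l: "\<tau> * (a - \<alpha>) < l" "ereal l < dist_to_set x {y. f y \<le> ereal \<alpha>}"
    using ereal_dense2[OF far] by auto
  have lpos: "l > 0" using l(1) x(2) \<open>\<tau> > 0\<close> by (smt (verit) mult_pos_pos)
  define K where "K = (a - \<alpha>) / l"
  have K: "K > 0" "K < 1 / \<tau>" using lpos l(1) x(2) \<open>\<tau> > 0\<close> by (auto simp: K_def field_simps)
  \<comment> \<open>\<open>real_of_ereal\<close> sends infinity to 0, so \<open>g\<close> is
    meaningful only on the effective domain, which is the set \<open>C\<close> given to Ekeland's
    principle.\<close>
  define g where "g y = max (real_of_ereal (f y) - \<alpha>) 0" for y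
  have g_le: "g y \<le> c \<longleftrightarrow> 0 \<le> c \<and> f y \<le> ereal (\<alpha> + c)" if "f y < \<infinity>" for y c
    using that nminf[of y] by (cases "f y") (auto simp: g_def)
  have "closed {y \<in> {y. f y < \<infinity>}. g y \<le> c}" for c
  proof (cases "c \<ge> 0")
    case True
    moreover have "f y < \<infinity>" if "f y \<le> ereal (\<alpha> + c)" for y
      using that by (rule le_less_trans) simp
    ultimately have "{y \<in> {y. f y < \<infinity>}. g y \<le> c} = {y. f y \<le> ereal (\<alpha> + c)}"
      using g_le by blast
    then show ?thesis using lsc_fun_closed_sublevel[OF lsc] by simp
  next
    case False
    then have "{y \<in> {y. f y < \<infinity>}. g y \<le> c} = {}" using g_le by auto
    then show ?thesis by (simp only: closed_empty)
  qed
  then obtain z where z: "f z < \<infinity>" "g z + K * dist z x \<le> g x"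
      "\<And>y. f y < \<infinity> \<Longrightarrow> g z \<le> g y + K * dist y z"
    by (rule Ekeland[where C = "{y. f y < \<infinity>}" and x = x and K = K])
      (use x K in \<open>auto simp: g_def\<close>)
  have gx: "g x = a - \<alpha>" using x by (simp add: g_def)
  have "f z > ereal \<alpha>"
  proof (rule ccontr)
    assume "\<not> ?thesis"
    then have "dist_to_set x {y. f y \<le> ereal \<alpha>} \<le> ereal (norm (x - z))"
      unfolding dist_to_set_def by (intro INF_lower) auto
    with l(2) have "ereal l < ereal (norm (x - z))" by (rule less_le_trans)
    then have "l < dist z x" by (simp add: dist_norm norm_minus_commute)
    then have "K * l < K * dist z x" using K by simp
    moreover have "K * l = a - \<alpha>" using lpos by (simp add: K_def)
    moreover have "g z \<ge> 0" by (simp add: g_def)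
    ultimately show False using z(2) gx by linarith
  qed
  moreover obtain b where b: "f z = ereal b" using z(1) nminf[of z] by (cases "f z") auto
  ultimately have "b > \<alpha>" by simp
  then have gz: "g z = b - \<alpha>" using b by (simp add: g_def)
  have "K * dist z x \<ge> 0" using K by simp
  then have "b \<le> a" using z(2) gx gz by linarith
  have slope: "b - K * norm (y - z) \<le> c" if y: "f y = ereal c" for y c
  proof (cases "c > \<alpha>")
    case True
    then show ?thesis using z(3)[of y] gz y b by (simp add: g_def dist_norm)
  next
    case False
    \<comment> \<open>Below level \<alpha> the truncation hides \<open>f\<close>. This
      \<open>t\<close> puts the convexity bound at \<open>?w\<close> halfway between
      \<open>b\<close> and \<alpha>; the Ekeland inequality there, divided by \<open>t\<close>,
      gives the slope bound at \<open>y\<close>.\<close>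
    define t where "t = (b - \<alpha>) / 2 / (b - c)"
    have "b - c \<noteq> 0" using False \<open>b > \<alpha>\<close> by simp
    then have "t * (b - c) = (b - \<alpha>) / 2" using t_def by (metis nonzero_divide_eq_eq)
    then have t: "0 < t" "t < 1" "t * (b - c) \<le> b - \<alpha>"
      using False \<open>b > \<alpha>\<close> by (simp_all add: t_def)
    let ?w = "(1 - t) *\<^sub>R z + t *\<^sub>R y"
    have fw: "f ?w \<le> ereal ((1 - t) * b + t * c)"
      by (rule convex_funD[OF conv]) (use b y t in auto)
    then have "f ?w < \<infinity>" by (auto intro: le_less_trans)
    moreover have "g ?w \<le> (1 - t) * b + t * c - \<alpha>"
    proof -
      have "0 \<le> (1 - t) * b + t * c - \<alpha>" using t(3) by (simp add: algebra_simps)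
      moreover have "f ?w \<le> ereal (\<alpha> + ((1 - t) * b + t * c - \<alpha>))" using fw by simp
      ultimately show ?thesis using g_le[OF \<open>f ?w < \<infinity>\<close>] by blast
    qed
    moreover have "dist ?w z = t * norm (y - z)"
    proof -
      have "?w - z = t *\<^sub>R (y - z)" by (simp add: algebra_simps)
      then show ?thesis using t by (simp add: dist_norm)
    qed
    ultimately have "b - \<alpha> \<le> (1 - t) * b + t * c - \<alpha> + K * (t * norm (y - z))"
      using z(3)[of ?w] gz by simp
    then have "0 \<le> t * (c - b + K * norm (y - z))" by (simp add: algebra_simps)
    then show ?thesis using t(1) by (simp add: zero_le_mult_iff)
  qed
  obtain u where "u \<in> subdifferential f z" "norm u \<le> K"
    using subgradient_of_slope_bound[OF conv nminf b less_imp_le[OF K(1)] slope] by blast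
  with K \<open>b > \<alpha>\<close> \<open>b \<le> a\<close> b x show thesis by (intro that[of z u]) auto
qed

text \<open>Here \<open>z\<close> is an Ekeland-approximate projection of \<open>x\<close> onto \<open>[f \<le> \<alpha>]\<close>. If \<open>f\<close> fell too steeply
  from \<open>z\<close> to some \<open>y\<close>, then the segment from \<open>x\<close> to \<open>y\<close> would reach \<open>[f \<le> \<alpha>]\<close> closer to \<open>x\<close>.\<close>

lemma small_subgradient_on_level:
  fixes f :: "'a::banach \<Rightarrow> ereal"
  assumes conv: "convex_fun f" and lsc: "lsc_fun f" and nminf: "\<And>x. f x \<noteq> -\<infinity>"
    and x: "f x = ereal a" "\<alpha> < a" and "\<tau> > 0"
    and x0: "f x0 \<le> ereal \<alpha>"
    and far: "ereal (\<tau> * (a - \<alpha>)) < dist_to_set x {y. f y \<le> ereal \<alpha>}"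
  obtains z u where "f z = ereal \<alpha>" "u \<in> subdifferential f z" "norm u < 1 / \<tau>"
proof -
  let ?S = "{y. f y \<le> ereal \<alpha>}"
  obtain l where l: "\<tau> * (a - \<alpha>) < l" "ereal l < dist_to_set x ?S"
    using ereal_dense2[OF far] by auto
  have lpos: "l > 0" using l(1) x(2) \<open>\<tau> > 0\<close> by (smt (verit) mult_pos_pos)
  have dist_l: "l < norm (z - x)" if "f z \<le> ereal \<alpha>" for z
  proof -
    have "dist_to_set x ?S \<le> ereal (norm (x - z))"
      unfolding dist_to_set_def using that by (intro INF_lower) auto
    with l(2) have "ereal l < ereal (norm (x - z))" by (rule less_le_trans)
    then show ?thesis by (simp add: norm_minus_commute)
  qed
  define h where "h = a - \<alpha>"
  have h: "h > 0" "\<tau> * h < l" using x l by (auto simp: h_def)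
  \<comment> \<open>The solution of \<open>e_eq\<close>: the loss factor
    \<open>(1 + e) / (1 - e)\<close> in the slope \<open>K\<close> below just uses up the gap
    between \<open>\<tau> * h\<close> and \<open>l\<close>, and \<open>?r > l\<close> makes
    \<open>K < 1 / \<tau>\<close> strict.\<close>
  define e where "e = (l - \<tau> * h) / (l + \<tau> * h)"
  have "\<tau> * h > 0" using h \<open>\<tau> > 0\<close> by simp
  then have e: "0 < e" "e < 1" and e_eq: "(1 + e) * (\<tau> * h) = (1 - e) * l"
    using h by (auto simp: e_def field_simps)
  have "closed {y \<in> ?S. norm (y - x) \<le> c}" for c
  proof -
    have "closed (?S \<inter> cball x c)" using lsc_fun_closed_sublevel[OF lsc] by auto
    moreover have "{y \<in> ?S. norm (y - x) \<le> c} = ?S \<inter> cball x c"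
      by (auto simp: dist_norm norm_minus_commute)
    ultimately show ?thesis by simp
  qed
  then obtain z where z: "f z \<le> ereal \<alpha>"
      "\<And>y. f y \<le> ereal \<alpha> \<Longrightarrow> norm (z - x) \<le> norm (y - x) + e * dist y z"
    by (rule Ekeland[where C = ?S and x = x0 and K = e]) (use x0 e in auto)
  obtain b where b: "f z = ereal b" using z(1) nminf[of z] by (cases "f z") auto
  let ?r = "norm (z - x)"
  have r: "?r > l" using dist_l[OF z(1)] .
  \<comment> \<open>If \<open>f z < \<alpha>\<close>, some step from \<open>z\<close> towards
    \<open>x\<close> stays in the level set. It shortens the distance to \<open>x\<close> by
    \<open>t * ?r\<close> at a penalty of only \<open>e * t * ?r\<close>, contradicting the choice
    of \<open>z\<close>.\<close>
  have "b = \<alpha>"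
  proof (rule ccontr)
    assume "b \<noteq> \<alpha>"
    with z(1) b have "b < \<alpha>" by simp
    define t where "t = (\<alpha> - b) / (a - b)"
    have "t * (a - b) = \<alpha> - b" using \<open>b < \<alpha>\<close> x(2) by (simp add: t_def)
    then have "(1 - t) * b + t * a = \<alpha>" by (simp add: algebra_simps)
    moreover have "0 < t" "t < 1" using \<open>b < \<alpha>\<close> x(2) by (simp_all add: t_def)
    ultimately have t: "0 < t" "t < 1" "(1 - t) * b + t * a = \<alpha>" by simp_all
    let ?w = "(1 - t) *\<^sub>R z + t *\<^sub>R x"
    have "f ?w \<le> ereal \<alpha>"
      using convex_funD[OF conv, of z b x a t] b x t by simp
    then have "?r \<le> norm (?w - x) + e * dist ?w z" by (rule z(2))
    moreover have "norm (?w - x) = (1 - t) * ?r"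
    proof -
      have "?w - x = (1 - t) *\<^sub>R (z - x)" by (simp add: algebra_simps)
      then show ?thesis using t by simp
    qed
    moreover have "dist ?w z = t * ?r"
    proof -
      have "?w - z = t *\<^sub>R (x - z)" by (simp add: algebra_simps)
      then show ?thesis using t by (simp add: dist_norm norm_minus_commute)
    qed
    ultimately have "t * (1 - e) * ?r \<le> 0" by (simp add: algebra_simps)
    moreover have "t * (1 - e) * ?r > 0" using t e r lpos by (intro mult_pos_pos) auto
    ultimately show False by simp
  qed
  define K where "K = (1 + e) * h / ((1 - e) * ?r)"
  have rpos: "?r > 0" using r lpos by linarith
  have "K > 0" using e h rpos by (auto simp: K_def)
  have "K < 1 / \<tau>"
  proof -
    have "(1 - e) * l < (1 - e) * ?r" using r e by simp
    then show ?thesis using e_eq e rpos \<open>\<tau> > 0\<close> by (simp add: K_def field_simps)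
  qed
  have slope: "\<alpha> - K * norm (y - z) \<le> c" if y: "f y = ereal c" for y c
  proof (rule ccontr)
    assume "\<not> ?thesis"
    then have less: "K * norm (y - z) < \<alpha> - c" by simp
    have "K * norm (y - z) \<ge> 0" using \<open>K > 0\<close> by simp
    with less have c: "c < \<alpha>" by linarith
    \<comment> \<open>The segment from \<open>x\<close> to \<open>y\<close> is cut where the affine
      bound on \<open>f\<close> equals \<alpha>, so \<open>?w\<close> competes with
      \<open>z\<close>.\<close>
    define t where "t = h / (a - c)"
    have "t * (a - c) = a - \<alpha>" using c x(2) by (simp add: t_def h_def)
    then have t: "(1 - t) * a + t * c = \<alpha>" "(1 - t) * h = t * (\<alpha> - c)"
      by (simp_all add: h_def algebra_simps)
    have t01: "0 < t" "t < 1" using c x(2) by (simp_all add: t_def h_def)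
    let ?w = "(1 - t) *\<^sub>R x + t *\<^sub>R y"
    let ?b = "norm (y - z)"
    have "f ?w \<le> ereal \<alpha>"
      using convex_funD[OF conv, of x a y c t] x y t t01 by simp
    then have "?r \<le> norm (?w - x) + e * dist ?w z" by (rule z(2))
    moreover have "norm (?w - x) \<le> t * (?b + ?r)"
    proof -
      have "?w - x = t *\<^sub>R (y - x)" by (simp add: algebra_simps)
      moreover have "norm (y - x) \<le> ?b + ?r"
        using norm_triangle_ineq[of "y - z" "z - x"] by simp
      ultimately show ?thesis using t01 by simp
    qed
    moreover have "e * dist ?w z \<le> e * ((1 - t) * ?r + t * ?b)"
    proof -
      have "?w - z = (1 - t) *\<^sub>R (x - z) + t *\<^sub>R (y - z)" by (simp add: algebra_simps)
      then have "norm (?w - z) \<le> norm ((1 - t) *\<^sub>R (x - z)) + norm (t *\<^sub>R (y - z))"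
        by (metis norm_triangle_ineq)
      then show ?thesis using t01 e by (simp add: dist_norm norm_minus_commute)
    qed
    ultimately have "(1 - t) * (1 - e) * ?r \<le> t * (1 + e) * ?b"
      by (simp add: algebra_simps)
    \<comment> \<open>Multiplying by \<open>h\<close> allows
      \<open>(1 - t) * h = t * (\<alpha> - c)\<close> and the definition of \<open>K\<close> to turn
      this into \<open>\<alpha> - c \<le> K * ?b\<close>, against \<open>less\<close>.\<close>
    then have "((1 - t) * (1 - e) * ?r) * h \<le> (t * (1 + e) * ?b) * h"
      using h by (intro mult_right_mono) auto
    moreover have "((1 - t) * (1 - e) * ?r) * h = (t * (\<alpha> - c)) * ((1 - e) * ?r)"
      by (simp add: t(2)[symmetric])
    moreover have "(t * (1 + e) * ?b) * h = (t * (K * ?b)) * ((1 - e) * ?r)"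
      using e rpos by (simp add: K_def)
    moreover have "(t * (K * ?b)) * ((1 - e) * ?r) < (t * (\<alpha> - c)) * ((1 - e) * ?r)"
      using less t01 e rpos by (intro mult_strict_right_mono mult_strict_left_mono mult_pos_pos) auto
    ultimately show False by linarith
  qed
  obtain u where "u \<in> subdifferential f z" "norm u \<le> K"
    using subgradient_of_slope_bound[OF conv nminf b[unfolded \<open>b = \<alpha>\<close>] less_imp_le[OF \<open>K > 0\<close>] slope]
    by blast
  with b \<open>b = \<alpha>\<close> \<open>K < 1 / \<tau>\<close> show thesis by (intro that[of z u]) auto
qed

section \<open>From the error bound to subgradients, and the equivalence\<close>

text \<open>A subgradient \<open>u\<close> cannot let \<open>f\<close> drop by
  \<open>a - \<alpha>\<close> within distance less than \<open>(a - \<alpha>) / norm u\<close>, so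
  this quotient bounds the distance to the level set from below.\<close>

lemma subgradient_norm_ge_of_error_bound:
  assumes x: "f x = ereal a" "\<alpha> < a" and "\<tau> > 0"
    and near: "dist_to_set x {y. f y \<le> ereal \<alpha>} \<le> ereal (\<tau> * (a - \<alpha>))"
    and u: "u \<in> subdifferential f x"
  shows "1 / \<tau> \<le> norm u"
proof (rule ccontr)
  assume "\<not> ?thesis"
  then have less: "\<tau> * norm u < 1" using \<open>\<tau> > 0\<close> by (simp add: field_simps)
  have bound: "a - \<alpha> \<le> norm u * norm (x - y)" if "f y \<le> ereal \<alpha>" for y
  proof -
    have "ereal (blinfun_apply u (y - x)) \<le> f y - f x"
      using u by (auto simp: subdifferential_def)
    also have "\<dots> \<le> ereal \<alpha> - ereal a" using that x by (intro ereal_minus_mono) auto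
    finally have "blinfun_apply u (y - x) \<le> \<alpha> - a" by simp
    moreover have "\<bar>blinfun_apply u (y - x)\<bar> \<le> norm u * norm (x - y)"
      using norm_blinfun[of u "y - x"] by (simp add: norm_minus_commute)
    ultimately show ?thesis by linarith
  qed
  show False
  \<comment> \<open>If \<open>u = 0\<close>, then \<open>x\<close> minimises \<open>f\<close> and
    the level set is empty; its distance is infinite, contrary to \<open>near\<close>.\<close>
  proof (cases "norm u = 0")
    case True
    then have "{y. f y \<le> ereal \<alpha>} = {}" using bound x(2) by fastforce
    then show False using near by (simp add: dist_to_set_def top_ereal_def)
  next
    case False
    then have "ereal ((a - \<alpha>) / norm u) \<le> dist_to_set x {y. f y \<le> ereal \<alpha>}"
      unfolding dist_to_set_def using bound by (intro INF_greatest) (auto simp: field_simps)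
    with near have "ereal ((a - \<alpha>) / norm u) \<le> ereal (\<tau> * (a - \<alpha>))" by (rule order_trans[rotated])
    then have "(a - \<alpha>) * 1 \<le> (a - \<alpha>) * (\<tau> * norm u)" using False by (simp add: field_simps)
    then show False using less x(2) by simp
  qed
qed

text \<open>Nonemptiness of [f \<le> \<alpha>] guards the first implication: for the constant
  function \<alpha> + 1 and \<beta> infinite, (i) holds vacuously, while the subgradient 0 violates
  (ii).\<close>

theorem theorem13:
  fixes f :: "'a::banach \<Rightarrow> ereal" and \<alpha> \<tau> :: real and \<beta> :: ereal
  assumes "proper_fun f" and "lsc_fun f" and "convex_fun f"
    and "ereal \<alpha> < \<beta>" and "\<tau> > 0"
  defines "cond_i \<equiv>
      (INF x\<in>{x. f x = ereal \<alpha>}. dist_to_set 0 (subdifferential f x)) \<ge> ereal (1 / \<tau>)"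
    and "cond_ii \<equiv>
      (INF x\<in>{x. ereal \<alpha> < f x \<and> f x < \<beta>}. dist_to_set 0 (subdifferential f x)) \<ge> ereal (1 / \<tau>)"
    and "cond_iii \<equiv>
      (\<forall>x\<in>{x. ereal \<alpha> < f x \<and> f x < \<beta>}.
         ereal \<tau> * (f x - ereal \<alpha>) \<ge> dist_to_set x {y. f y \<le> ereal \<alpha>})"
  shows "({x. f x \<le> ereal \<alpha>} \<noteq> {} \<longrightarrow> cond_i \<longrightarrow> cond_ii) \<and> (cond_ii \<longleftrightarrow> cond_iii)"
proof -
  have nminf: "f x \<noteq> -\<infinity>" for x using assms(1) by (auto simp: proper_fun_def)
  \<comment> \<open>An empty subdifferential has distance infinity, so such points impose no
    condition.\<close>
  have i: "cond_i \<longleftrightarrow> (\<forall>x u. f x = ereal \<alpha> \<and> u \<in> subdifferential f x \<longrightarrow> 1 / \<tau> \<le> norm u)"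
    by (auto simp: cond_i_def dist_to_set_def le_INF_iff)
  have ii: "cond_ii \<longleftrightarrow> (\<forall>x u. ereal \<alpha> < f x \<and> f x < \<beta> \<and> u \<in> subdifferential f x \<longrightarrow> 1 / \<tau> \<le> norm u)"
    by (auto simp: cond_ii_def dist_to_set_def le_INF_iff)
  let ?d = "\<lambda>x. dist_to_set x {y. f y \<le> ereal \<alpha>}"
  have real: "\<exists>a. f x = ereal a \<and> \<alpha> < a" if "ereal \<alpha> < f x" "f x < \<beta>" for x
    using that by (cases "f x") auto
  have iii: "cond_iii \<longleftrightarrow> (\<forall>x a. f x = ereal a \<and> \<alpha> < a \<and> f x < \<beta> \<longrightarrow> ?d x \<le> ereal (\<tau> * (a - \<alpha>)))"
    unfolding cond_iii_def using real by force
  have "cond_iii" if "cond_ii"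
    unfolding iii
  proof (intro allI impI, rule ccontr)
    fix x a assume x: "f x = ereal a \<and> \<alpha> < a \<and> f x < \<beta>" and "\<not> ?d x \<le> ereal (\<tau> * (a - \<alpha>))"
    then obtain z u where "ereal \<alpha> < f z" "f z \<le> f x" "u \<in> subdifferential f z" "norm u < 1 / \<tau>"
      using small_subgradient_above_level[OF assms(3,2) nminf, of x a \<alpha> \<tau>] \<open>\<tau> > 0\<close>
      by (auto simp: not_le)
    \<comment> \<open>\<open>f z \<le> f x < \<beta>\<close> keeps \<open>z\<close> inside the strip
      of (ii).\<close>
    with that x show False unfolding ii by (meson le_less_trans not_le)
  qed
  moreover have "cond_ii" if "cond_iii"
    unfolding ii
  proof (intro allI impI)
    fix x u assume x: "ereal \<alpha> < f x \<and> f x < \<beta> \<and> u \<in> subdifferential f x"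
    then obtain a where a: "f x = ereal a" "\<alpha> < a" using real by blast
    with x that have "?d x \<le> ereal (\<tau> * (a - \<alpha>))" unfolding iii by blast
    with a x \<open>\<tau> > 0\<close> show "1 / \<tau> \<le> norm u"
      by (intro subgradient_norm_ge_of_error_bound) auto
  qed
  moreover have "cond_iii" if ne: "{x. f x \<le> ereal \<alpha>} \<noteq> {}" and "cond_i"
    unfolding iii
  proof (intro allI impI, rule ccontr)
    fix x a assume x: "f x = ereal a \<and> \<alpha> < a \<and> f x < \<beta>" and "\<not> ?d x \<le> ereal (\<tau> * (a - \<alpha>))"
    moreover obtain x0 where "f x0 \<le> ereal \<alpha>" using ne by blast
    ultimately obtain z u where "f z = ereal \<alpha>" "u \<in> subdifferential f z" "norm u < 1 / \<tau>"
      using small_subgradient_on_level[OF assms(3,2) nminf, of x a \<alpha> \<tau>] \<open>\<tau> > 0\<close>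
      by (auto simp: not_le)
    with \<open>cond_i\<close> show False unfolding i by fastforce
  qed
  ultimately show ?thesis by blast
qed

end
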